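(* Let $W$ be an irreducible $T$-module with endpoint $r$ and diameter $d=D-2r$. Then the following hold for $0\le i,j\le d$ and nonzero vectors $u\in E_rW$, $u^*\in E^*_rW$, $u^{\varepsilon}\in E^{\varepsilon}_rW$. (i) $$\langle E_{r+i}u^{\varepsilon},E^*_{r+j}u\rangle=\mathbf{i}^i\,2^{-d}\langle u^{\varepsilon},u\rangle\binom{d}{i}\binom{d}{j}\;{}_2F_1\Big({-i,-j\atop -d};2\Big).$$ (ii) $$\langle E^*_{r+i}u,E^{\varepsilon}_{r+j}u^*\rangle=\mathbf{i}^i\,2^{-d}\langle u,u^*\rangle\binom{d}{i}\binom{d}{j}\;{}_2F_1\Big({-i,-j\atop -d};2\Big).$$ (iii) $$\langle E^{\varepsilon}_{r+i}u^*,E_{r+j}u^{\varepsilon}\rangle=\mathbf{i}^i\,2^{-d}\langle u^*,u^{\varepsilon}\rangle\binom{d}{i}\binom{d}{j}\;{}_2F_1\Big({-i,-j\atop -d};2\Big).$$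
   Context: Let $D$ be a positive integer and let $Q_D$ be the $D$-cube: the graph with vertex set $X=\{0,1\}^D$, two vertices being adjacent iff they differ in exactly one coordinate; $\partial$ denotes path-length distance. $\mathrm{Mat}_X(\mathbb{C})$ is the algebra of complex matrices with rows and columns indexed by $X$, acting on $V=\mathbb{C}^X$ (column vectors) by left multiplication. $V$ carries the Hermitian inner product $\langle v,w\rangle=v^t\overline{w}$ (linear in the first argument). Write $\mathbf{i}^2=-1$ (the bold $\mathbf{i}$ is the imaginary unit; the plain $i$ is an index). Let $A$ be the adjacency matrix of $Q_D$. Fix $x=(0,0,\ldots,0)\in X$. Let $A^*$ be the diagonal matrix in $\mathrm{Mat}_X(\mathbb{C})$ with $(y,y)$-entry $D-2\partial(x,y)$ for $y\in X$, and let $A^{\varepsilon}=-\mathbf{i}(AA^*-A^*A)/2$. Let $T$ be the subalgebra of $\mathrm{Mat}_X(\mathbb{C})$ generated by $A$ and $A^*$. The eigenvalues of $A$ are $\theta_i=D-2i$ $(0\le i\le D)$. For $0\le i\le D$: $E_i=\prod_{0\le j\le D,\,j\ne i}\frac{A-\theta_jI}{\theta_i-\theta_j}$ is the primitive idempotent of $A$ for $\theta_i$ (the orthogonal projection onto the $\theta_i$-eigenspace of $A$); $E_i^*$ is the diagonal matrix with $(y,y)$-entry $1$ if $\partial(x,y)=i$ and $0$ otherwise; and $E_i^{\varepsilon}=P^{-1}E_iP$, where $P=P_1^{\otimes D}$ (Kronecker power, $P_{yz}=\prod_{k=1}^D(P_1)_{y_kz_k}$, invertible) with $P_1=\begin{pmatrix}1&1\\-\mathbf{i}&\mathbf{i}\end{pmatrix}$,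 rows and columns indexed by $0,1$ in that order. ($E_i^*$ and $E_i^{\varepsilon}$ are the primitive idempotents of $A^*$ and $A^{\varepsilon}$ for the eigenvalue $D-2i$.) A $T$-module is a subspace $W\subseteq V$ with $BW\subseteq W$ for all $B\in T$; it is irreducible if $W\ne0$ and it contains no $T$-modules other than $0$ and $W$. The endpoint of an irreducible $T$-module $W$ is $r=\min\{i\mid 0\le i\le D,\ E_i^*W\neq0\}$ (it is known that also $r=\min\{i\mid E_iW\ne0\}$), and its diameter is $d=|\{i\mid 0\le i\le D,\ E_i^*W\ne0\}|-1$; it is known that $d=D-2r$ and $0\le r\le D/2$. For $a\in\mathbb{C}$ and an integer $n\ge0$, $(a)_n=a(a+1)\cdots(a+n-1)$ with $(a)_0=1$. For integers $0\le i,j\le d$, ${}_2F_1\big({-i,-j\atop -d};2\big)=\sum_{n=0}^d\frac{(-i)_n(-j)_n}{(-d)_n\,n!}2^n$. *)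

theory Defs
  imports "HOL-Analysis.Analysis"
begin

text \<open>
  The coordinates of the \<open>D\<close>-cube are indexed by a finite type \<open>'n\<close> with \<open>D = CARD('n)\<close>, so that
  \<open>D\<close> is an arbitrary positive integer. A vertex is an element of \<open>bool ^ 'n\<close>, where \<open>False\<close> and
  \<open>True\<close> stand for the coordinate values 0 and 1.
\<close>

type_synonym 'n vertex = "bool ^ 'n"
type_synonym 'n cvec = "complex ^ (bool ^ 'n)"
type_synonym 'n cmat = "complex ^ (bool ^ 'n) ^ (bool ^ 'n)"

definition cube_adj :: "'n::finite vertex \<Rightarrow> 'n vertex \<Rightarrow> bool" where
  "cube_adj y z \<longleftrightarrow> card {k. y $ k \<noteq> z $ k} = 1"

definition cube_dist :: "'n::finite vertex \<Rightarrow> 'n vertex \<Rightarrow> nat" where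
  "cube_dist y z = (LEAST n. (cube_adj ^^ n) y z)"

definition base_vertex :: "'n::finite vertex" where
  "base_vertex = (\<chi> k. False)"

definition herm :: "'n::finite cvec \<Rightarrow> 'n cvec \<Rightarrow> complex" where
  "herm v w = (\<Sum>y\<in>UNIV. v $ y * cnj (w $ y))"

text \<open>The type class multiplications on nested vectors act componentwise; the matrix product
  is \<open>**\<close>, and multiplication of a matrix by a scalar is the following operation.\<close>

definition mscale :: "complex \<Rightarrow> 'n::finite cmat \<Rightarrow> 'n cmat" where
  "mscale c M = (\<chi> y z. c * M $ y $ z)"

definition cube_A :: "'n::finite cmat" where
  "cube_A = (\<chi> y z. if cube_adj y z then 1 else 0)"

definition theta :: "nat \<Rightarrow> nat \<Rightarrow> complex" where
  "theta D i = of_nat D - 2 * of_nat i"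

definition cube_Astar :: "'n::finite cmat" where
  "cube_Astar = (\<chi> y z. if y = z then theta CARD('n) (cube_dist base_vertex y) else 0)"

inductive_set generated_algebra :: "'n::finite cmat set \<Rightarrow> 'n cmat set" for S where
  gen: "M \<in> S \<Longrightarrow> M \<in> generated_algebra S"
| one: "mat 1 \<in> generated_algebra S"
| add: "M \<in> generated_algebra S \<Longrightarrow> N \<in> generated_algebra S \<Longrightarrow> M + N \<in> generated_algebra S"
| scale: "M \<in> generated_algebra S \<Longrightarrow> mscale c M \<in> generated_algebra S"
| mult: "M \<in> generated_algebra S \<Longrightarrow> N \<in> generated_algebra S \<Longrightarrow> M ** N \<in> generated_algebra S"

definition cube_T :: "'n::finite cmat set" where
  "cube_T = generated_algebra {cube_A, cube_Astar}"

text \<open>The factors of the product commute, so the order in which they are listed is immaterial.\<close>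

definition E_prim :: "nat \<Rightarrow> 'n::finite cmat" where
  "E_prim i = foldr (**)
     (map (\<lambda>j. mscale (1 / (theta CARD('n) i - theta CARD('n) j))
                      (cube_A - mscale (theta CARD('n) j) (mat 1)))
          (filter (\<lambda>j. j \<noteq> i) [0..<Suc CARD('n)]))
     (mat 1)"

definition Estar_prim :: "nat \<Rightarrow> 'n::finite cmat" where
  "Estar_prim i = (\<chi> y z. if y = z \<and> cube_dist base_vertex y = i then 1 else 0)"

definition P1 :: "bool \<Rightarrow> bool \<Rightarrow> complex" where
  "P1 a b = (if a then (if b then \<i> else - \<i>) else 1)"

definition cube_P :: "'n::finite cmat" where
  "cube_P = (\<chi> y z. \<Prod>k\<in>UNIV. P1 (y $ k) (z $ k))"

definition Eeps_prim :: "nat \<Rightarrow> 'n::finite cmat" where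
  "Eeps_prim i = matrix_inv cube_P ** E_prim i ** cube_P"

text \<open>Complex subspaces are \<open>vec.subspace\<close>; the unqualified \<open>subspace\<close> is the real notion.\<close>

definition T_module :: "'n::finite cvec set \<Rightarrow> bool" where
  "T_module W \<longleftrightarrow> vec.subspace W \<and> (\<forall>B\<in>cube_T. (*v) B ` W \<subseteq> W)"

definition irreducible_T_module :: "'n::finite cvec set \<Rightarrow> bool" where
  "irreducible_T_module W \<longleftrightarrow>
     T_module W \<and> W \<noteq> {0} \<and> (\<forall>U. T_module U \<and> U \<subseteq> W \<longrightarrow> U = {0} \<or> U = W)"

definition module_endpoint :: "'n::finite cvec set \<Rightarrow> nat" where
  "module_endpoint W = Min {i. i \<le> CARD('n) \<and> (*v) (Estar_prim i) ` W \<noteq> {0}}"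

definition module_diameter :: "'n::finite cvec set \<Rightarrow> nat" where
  "module_diameter W = card {i. i \<le> CARD('n) \<and> (*v) (Estar_prim i) ` W \<noteq> {0}} - 1"

text \<open>The terminating sum for \<open>{}\<^sub>2F\<^sub>1(-i, -j; -d; 2)\<close>, used for \<open>i, j \<le> d\<close>; the
  denominators do not vanish since \<open>n \<le> d\<close>.\<close>

definition hyp2F1 :: "nat \<Rightarrow> nat \<Rightarrow> nat \<Rightarrow> complex" where
  "hyp2F1 d i j = (\<Sum>n\<le>d. pochhammer (- of_nat i) n * pochhammer (- of_nat j) n
                          / (pochhammer (- of_nat d) n * fact n) * 2 ^ n)"

end

theory Submission
  imports Defs "HOL-Computational_Algebra.Polynomial"
begin

text \<open>
  Put \<open>X = A\<close>, \<open>Y = A\<^sup>*\<close>, \<open>Z = A\<^sup>\<epsilon>\<close>. These self-adjoint operators satisfy \<open>[X, Y] = 2\<i>Z\<close> and its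
  cyclic shifts, so that \<open>Y \<plusminus> \<i>Z\<close> shifts the \<open>X\<close>-eigenvalue by \<open>\<plusminus>2\<close>. If \<open>u\<close> has the largest
  \<open>X\<close>-eigenvalue \<open>m\<close> occurring in \<open>W\<close>, then \<open>Y u + \<i>Z u = 0\<close>; taking \<open>Y\<close>-components \<open>u\<^sub>k\<close> of \<open>u\<close>, this
  determines the action of \<open>X\<close> on the \<open>u\<^sub>k\<close>. The first nonzero \<open>u\<^sub>k\<close> has \<open>Y\<close>-eigenvalue \<open>m\<close>, so by cyclic
  symmetry all three operators have the same largest eigenvalue on \<open>W\<close>; the triple \<open>(-X, -Y, Z)\<close>
  gives the smallest one, and hence \<open>d = D - 2r\<close>.

  Similarly a vector \<open>v\<close> of largest \<open>Z\<close>-eigenvalue has \<open>X\<close>-components \<open>v\<^sub>k\<close> on which \<open>Y\<close> acts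
  explicitly. Moving \<open>X\<close> and \<open>Y\<close> across \<open>\<langle>v\<^sub>r\<^sub>+\<^sub>i, u\<^sub>r\<^sub>+\<^sub>j\<rangle>\<close> gives a recurrence in \<open>j\<close>, which is that of the
  coefficients of \<open>(1 + t)^(d - i) (1 - t)^i\<close>, and another one in \<open>i\<close> at \<open>j = 0\<close>, solved by \<open>\<i>^i (d choose i)\<close>. The
  remaining constant comes from \<open>\<langle>v, u\<rangle> = \<langle>v\<^sub>r, u\<rangle> = \<Sum>\<^sub>j \<langle>v\<^sub>r, u\<^sub>r\<^sub>+\<^sub>j\<rangle>\<close>. The three parts of the theorem are
  cyclic shifts of one another.
\<close>

section \<open>Krawtchouk polynomials\<close>

text \<open>Generating function of the binary Krawtchouk polynomials: the coefficient of
  \<open>t^j\<close> is the value at \<open>i\<close> of the polynomial of degree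
  \<open>j\<close>.\<close>

definition krawtchouk_gf :: "nat \<Rightarrow> nat \<Rightarrow> complex poly" where
  "krawtchouk_gf d i = [:1, 1:] ^ (d - i) * [:1, -1:] ^ i"

lemma linear_pderiv_power:
  "[:1, c:] * pderiv ([:1, c:] ^ n) = smult (of_nat n * c) ([:1, c:] ^ n)" for c :: complex
  by (cases n) (simp_all add: pderiv_power_Suc pderiv_pCons mult.commute del: power_Suc, simp add: algebra_simps)

text \<open>The logarithmic derivative is \<open>(d - i) / (1 + t) - i / (1 - t)\<close>;
  multiplying by \<open>1 - t^2\<close> clears the denominators.\<close>

lemma krawtchouk_gf_ode:
  assumes "i \<le> d"
  shows "[:1, 0, -1:] * pderiv (krawtchouk_gf d i)
    = [:of_nat d - 2 * of_nat i, - of_nat d:] * krawtchouk_gf d i"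
proof -
  have smult_combine: "u * q * smult a p + v * p * smult b q = (smult a u + smult b v) * (p * q)"
    for u v p q :: "complex poly" and a b
    by (simp add: algebra_simps smult_add_right)
  let ?p = "[:1, 1:] ^ (d - i) :: complex poly" and ?q = "[:1, -1:] ^ i :: complex poly"
  have "[:1, 0, -1:] * pderiv (krawtchouk_gf d i)
      = [:1, -1:] * ?q * ([:1, 1:] * pderiv ?p) + [:1, 1:] * ?p * ([:1, -1:] * pderiv ?q)"
    by (simp add: krawtchouk_gf_def pderiv_mult algebra_simps)
  also have "\<dots> = (smult (of_nat (d - i)) [:1, -1:] + smult (- of_nat i) [:1, 1:]) * (?p * ?q)"
    unfolding linear_pderiv_power smult_combine by simp
  also have "smult (of_nat (d - i)) [:1, -1:] + smult (- of_nat i) [:1, 1:]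
      = [:of_nat d - 2 * of_nat i, - of_nat d :: complex:]"
    using assms by (simp add: of_nat_diff)
  finally show ?thesis by (simp add: krawtchouk_gf_def)
qed

lemma krawtchouk_gf_coeff_0: "coeff (krawtchouk_gf d i) 0 = 1"
  by (simp add: krawtchouk_gf_def coeff_0_power coeff_mult_0)

lemma krawtchouk_gf_coeff_1:
  assumes "i \<le> d"
  shows "coeff (krawtchouk_gf d i) 1 = of_nat d - 2 * of_nat i"
  using arg_cong[OF krawtchouk_gf_ode[OF assms], of "\<lambda>p. coeff p 0"]
  by (simp add: coeff_pderiv krawtchouk_gf_coeff_0)

text \<open>Coefficients of \<open>t^(j+1)\<close> in the differential equation. The inner products
  in \<open>inner_product_components\<close> obey the same three-term recurrence.\<close>

lemma krawtchouk_gf_coeff_Suc: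
  assumes "i \<le> d"
  shows "of_nat (j + 2) * coeff (krawtchouk_gf d i) (Suc (Suc j))
       + (of_nat d - of_nat j) * coeff (krawtchouk_gf d i) j
    = (of_nat d - 2 * of_nat i) * coeff (krawtchouk_gf d i) (Suc j)"
  using arg_cong[OF krawtchouk_gf_ode[OF assms], of "\<lambda>p. coeff p (Suc j)"]
  by (cases j) (simp_all add: coeff_pderiv algebra_simps)

lemma coeff_one_plus_power: "coeff ([:1, 1:] ^ m) k = (of_nat (m choose k) :: complex)"
proof (cases "k \<le> m")
  case True
  then show ?thesis by (simp add: coeff_linear_poly_power)
next
  case False
  have "degree ([:1, 1:] ^ m :: complex poly) \<le> m"
    by (simp add: degree_linear_power)
  with False show ?thesis by (simp add: coeff_eq_0 binomial_eq_0)
qed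

text \<open>Binomial expansion of \<open>(1 - t)^i\<close> after writing
  \<open>1 - t = (1 + t) - 2t\<close>; the remaining powers of \<open>1 + t\<close> combine to
  exponent \<open>d - n\<close>.\<close>

lemma krawtchouk_gf_expand:
  assumes "i \<le> d"
  shows "krawtchouk_gf d i = (\<Sum>n\<le>i. monom (of_nat (i choose n) * (-2) ^ n) n * [:1, 1:] ^ (d - n))"
proof -
  have "[:1, -1:] = monom (-2) 1 + [:1, 1 :: complex:]"
    by (simp add: monom_altdef)
  then have "krawtchouk_gf d i = [:1, 1:] ^ (d - i) * (monom (-2) 1 + [:1, 1:]) ^ i"
    by (simp add: krawtchouk_gf_def)
  also have "\<dots> = (\<Sum>n\<le>i. monom (of_nat (i choose n) * (-2) ^ n) n * ([:1, 1:] ^ (d - i) * [:1, 1:] ^ (i - n)))"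
    unfolding binomial_ring sum_distrib_left
    by (intro sum.cong refl) (simp add: monom_power of_nat_monom mult_monom  mult.left_commute flip: mult.assoc)
  also have "\<dots> = (\<Sum>n\<le>i. monom (of_nat (i choose n) * (-2) ^ n) n * [:1, 1:] ^ (d - n))"
    using assms by (intro sum.cong refl) (simp flip: power_add)
  finally show ?thesis .
qed

lemma pochhammer_minus_of_nat: "pochhammer (- of_nat i) n = (-1) ^ n * fact n * (of_nat (i choose n) :: complex)"
proof -
  have "of_nat (i choose n) = (-1) ^ n / fact n * pochhammer (- of_nat i :: complex) n"
    by (simp add: binomial_gbinomial gbinomial_pochhammer)
  then show ?thesis
    by (simp add: mult.assoc flip: power_mult_distrib)
qed

text \<open>Term by term this is \<open>krawtchouk_gf_expand\<close>: the identity \<open>(d choose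
  j) (j choose n) = (d choose n) (d - n choose (j - n))\<close> cancels the factor
  \<open>d choose n\<close> coming from the denominator \<open>(-d)_n\<close>.\<close>

lemma hyp2F1_eq_coeff:
  assumes "i \<le> d" "j \<le> d"
  shows "of_nat (d choose j) * hyp2F1 d i j = coeff (krawtchouk_gf d i) j"
proof -
  have "of_nat (d choose j) * hyp2F1 d i j
    = (\<Sum>n\<le>d. of_nat (i choose n) * (-2) ^ n * (if n \<le> j then of_nat (d - n choose (j - n)) else 0))"
    unfolding hyp2F1_def sum_distrib_left
  proof (intro sum.cong refl)
    fix n assume "n \<in> {..d}"
    then have n: "n \<le> d" by simp
    have c: "of_nat (d choose n) \<noteq> (0 :: complex)" using n by simp
    show "of_nat (d choose j) * (pochhammer (- of_nat i) n * pochhammer (- of_nat j) n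
              / (pochhammer (- of_nat d) n * fact n) * 2 ^ n)
      = (of_nat (i choose n) * (-2) ^ n * (if n \<le> j then of_nat (d - n choose (j - n)) else 0) :: complex)"
    proof (cases "n \<le> j")
      case True
      have "(d choose j) * (j choose n) = (d choose n) * (d - n choose (j - n))"
        using True assms(2) by (rule choose_mult)
      then have e: "of_nat (d choose j) * of_nat (j choose n)
          = (of_nat (d choose n) * of_nat (d - n choose (j - n)) :: complex)"
        by (metis of_nat_mult)
      have p: "(-2) ^ n = (-1) ^ n * (2 :: complex) ^ n"
        by (simp flip: power_mult_distrib)
      have "of_nat (d choose j) * (pochhammer (- of_nat i) n * pochhammer (- of_nat j) n
              / (pochhammer (- of_nat d) n * fact n) * 2 ^ n)
        = of_nat (i choose n) * ((-1) ^ n * 2 ^ n) * (of_nat (d choose j) * of_nat (j choose n)) / (of_nat (d choose n) :: complex)"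
        unfolding pochhammer_minus_of_nat using c by (simp add: divide_simps)
      then show ?thesis unfolding e p using c True by simp
    qed (simp add: pochhammer_minus_of_nat binomial_eq_0)
  qed
  also have "\<dots> = (\<Sum>n\<le>i. of_nat (i choose n) * (-2) ^ n * (if n \<le> j then of_nat (d - n choose (j - n)) else 0))"
    using assms(1) by (intro sum.mono_neutral_right) (auto simp: binomial_eq_0)
  also have "\<dots> = coeff (krawtchouk_gf d i) j"
    unfolding krawtchouk_gf_expand[OF assms(1)] coeff_sum
    by (intro sum.cong refl) (simp add: coeff_monom_mult coeff_one_plus_power)
  finally show ?thesis .
qed

section \<open>Self-adjoint operators with cube spectrum\<close>

abbreviation clinear :: "('n::finite cvec \<Rightarrow> 'n cvec) \<Rightarrow> bool" where
  "clinear \<equiv> module_hom (*s) (*s)"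

lemma herm_add_left: "herm (u + v) w = herm u w + herm v w"
  by (simp add: herm_def algebra_simps sum.distrib)

lemma herm_diff_left: "herm (u - v) w = herm u w - herm v w"
  by (simp add: herm_def algebra_simps sum_subtractf)

lemma herm_scale_left: "herm (c *s v) w = c * herm v w"
  by (simp add: herm_def sum_distrib_left mult.assoc)

lemma herm_zero_left: "herm 0 w = 0"
  by (simp add: herm_def)

lemma herm_cnj: "cnj (herm v w) = herm w v"
  by (simp add: herm_def mult.commute)

lemma herm_add_right: "herm u (v + w) = herm u v + herm u w"
  by (simp add: herm_def algebra_simps sum.distrib)

lemma herm_scale_right: "herm v (c *s w) = cnj c * herm v w"
  by (simp add: herm_def sum_distrib_left algebra_simps)

lemma herm_zero_right: "herm w 0 = 0"
  by (simp add: herm_def)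

lemma herm_sum_right: "herm v (\<Sum>k\<in>K. f k) = (\<Sum>k\<in>K. herm v (f k))"
  by (induction K rule: infinite_finite_induct) (simp_all add: herm_zero_right herm_add_right)

lemma theta_eq_iff [simp]: "theta D k = theta D l \<longleftrightarrow> k = l"
  by (simp add: theta_def)

lemma cnj_theta [simp]: "cnj (theta D k) = theta D k"
  by (simp add: theta_def)

lemma theta_Suc: "theta D (Suc k) = theta D k - 2"
  by (simp add: theta_def)

text \<open>Operator form of the \<open>foldr\<close> product in \<open>E_prim\<close>, for an
  arbitrary \<open>X\<close>, so that each spectral projection is seen to be a polynomial in its
  operator.\<close>

primrec lagrange_op :: "nat \<Rightarrow> ('n::finite cvec \<Rightarrow> 'n cvec) \<Rightarrow> nat \<Rightarrow> nat list \<Rightarrow> 'n cvec \<Rightarrow> 'n cvec" where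
  "lagrange_op D X k [] w = w"
| "lagrange_op D X k (j # js) w = (1 / (theta D k - theta D j)) *s
     (X (lagrange_op D X k js w) - theta D j *s lagrange_op D X k js w)"

lemma lagrange_op_in_subspace:
  assumes "vec.subspace W" "\<And>w. w \<in> W \<Longrightarrow> X w \<in> W" "w \<in> W"
  shows "lagrange_op D X k js w \<in> W"
  by (induction js) (auto intro!: assms vec.subspace_scale vec.subspace_diff)

text \<open>Indices are recorded instead of eigenvalues. Index \<open>k\<close> stands for
  \<open>D - 2k\<close>, so the minimum belongs to the largest eigenvalue on
  \<open>W\<close>.\<close>

definition weights :: "nat \<Rightarrow> ('n::finite cvec \<Rightarrow> 'n cvec) \<Rightarrow> 'n cvec set \<Rightarrow> nat set" where
  "weights D X W = {k. k \<le> D \<and> (\<exists>w\<in>W. w \<noteq> 0 \<and> X w = theta D k *s w)}"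

lemma finite_weights: "finite (weights D X W)"
  by (rule finite_subset[of _ "{..D}"]) (auto simp: weights_def)

text \<open>A self-adjoint operator with spectrum contained in the \<open>theta D k\<close>, \<open>k \<le> D\<close>. The
  assumptions force \<open>P k\<close> to vanish for \<open>k > D\<close>.\<close>

locale weight_operator =
  fixes D :: nat and X :: "'n::finite cvec \<Rightarrow> 'n cvec" and P :: "nat \<Rightarrow> 'n cvec \<Rightarrow> 'n cvec"
  assumes linear_X: "clinear X"
    and linear_P: "clinear (P k)"
    and P_X: "P k (X w) = theta D k *s P k w"
    and X_P: "X (P k w) = theta D k *s P k w"
    and sum_P: "(\<Sum>k\<le>D. P k w) = w"
    and herm_X: "herm (X v) w = herm v (X w)"
begin

lemmas X_simps = module_hom.add[OF linear_X] module_hom.scale[OF linear_X]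
  module_hom.diff[OF linear_X] module_hom.zero[OF linear_X] module_hom.neg[OF linear_X]

lemmas P_simps = module_hom.add[OF linear_P] module_hom.scale[OF linear_P]
  module_hom.diff[OF linear_P] module_hom.zero[OF linear_P] module_hom.neg[OF linear_P]

lemma P_other_weight:
  assumes "X w = c *s w" "c \<noteq> theta D k"
  shows "P k w = 0"
proof -
  have "theta D k *s P k w = c *s P k w"
    using P_X[of k w] unfolding assms(1) P_simps by (rule sym)
  then show ?thesis using assms(2) vec.scale_right_imp_eq by metis
qed

lemma outside_spectrum:
  assumes "X w = c *s w" "\<And>k. k \<le> D \<Longrightarrow> c \<noteq> theta D k"
  shows "w = 0"
  using sum_P[of w] P_other_weight[OF assms(1) assms(2)] by simp

lemma P_own_weight:
  assumes "X w = theta D k *s w"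
  shows "P k w = w"
proof (cases "k \<le> D")
  case True
  have "(\<Sum>l\<le>D. P l w) = (\<Sum>l\<in>{k}. P l w)"
    using True P_other_weight[OF assms] by (intro sum.mono_neutral_right) auto
  then show ?thesis using sum_P[of w] by simp
next
  case False
  then have "w = 0" using outside_spectrum[OF assms] by auto
  then show ?thesis by (simp add: P_simps)
qed

lemma P_P: "P k (P l w) = (if k = l then P l w else 0)"
  using P_own_weight P_other_weight X_P by (metis theta_eq_iff)

lemma P_eq_0: "D < k \<Longrightarrow> P k w = 0"
  using outside_spectrum[OF X_P] by (metis leD theta_eq_iff)

lemma eq_if_components_eq:
  assumes "\<And>k. k \<le> D \<Longrightarrow> P k v = P k w"
  shows "v = w"
proof -
  have "(\<Sum>k\<le>D. P k v) = (\<Sum>k\<le>D. P k w)"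
    using assms by (intro sum.cong) auto
  then show ?thesis by (simp add: sum_P)
qed

lemma component_nonzero:
  assumes "w \<noteq> 0"
  obtains k where "k \<le> D" "P k w \<noteq> 0"
  using eq_if_components_eq[of w 0] assms by (metis P_simps(4))

text \<open>Eigenvectors of a self-adjoint operator for distinct real eigenvalues are orthogonal, so
  both sides reduce to \<open>herm (P k v) (P k w)\<close>.\<close>

lemma herm_P: "herm (P k v) w = herm v (P k w)"
proof -
  have orth: "herm (P k v) (P l w) = 0" if "k \<noteq> l" for k l v w
  proof -
    have "theta D k * herm (P k v) (P l w) = theta D l * herm (P k v) (P l w)"
      using herm_X[of "P k v" "P l w"] by (simp add: X_P herm_scale_left herm_scale_right)
    then show ?thesis using that by simp
  qed
  have "herm (P k v) w = herm (P k v) (P k w)" if "k \<le> D" for v w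
  proof -
    have "herm (P k v) w = (\<Sum>l\<le>D. herm (P k v) (P l w))"
      by (simp add: sum_P flip: herm_sum_right)
    also have "\<dots> = (\<Sum>l\<in>{k}. herm (P k v) (P l w))"
      using that orth by (intro sum.mono_neutral_right) auto
    finally show ?thesis by simp
  qed
  \<comment> \<open>The right-hand side is treated by exchanging \<open>v\<close> and
    \<open>w\<close> and conjugating; for \<open>k > D\<close> both sides are 0.\<close>
  from this[of v w] this[of w v, THEN arg_cong[of _ _ cnj]] show ?thesis
    by (cases "k \<le> D") (simp_all add: herm_cnj P_eq_0 herm_zero_left herm_zero_right)
qed

text \<open>The relation \<open>[X, T] = c T\<close> means that \<open>T\<close> moves eigenvalues
  by \<open>c\<close>, so only components with \<open>theta D l + c = theta D k\<close>
  contribute.\<close>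

lemma P_shift_gen:
  assumes "clinear T" "\<And>w. X (T w) = T (X w) + c *s T w"
  shows "X (T (P l w)) = (theta D l + c) *s T (P l w)"
    and "P k (T w) = (\<Sum>l\<le>D. if theta D k = theta D l + c then P k (T (P l w)) else 0)"
proof -
  interpret T: module_hom "(*s)" "(*s)" T by fact
  show 1: "X (T (P l w)) = (theta D l + c) *s T (P l w)" for l
    by (simp add: assms(2) X_P T.scale vec.scale_left_distrib)
  have "P k (T w) = P k (T (\<Sum>l\<le>D. P l w))" by (simp add: sum_P)
  also have "\<dots> = (\<Sum>l\<le>D. P k (T (P l w)))"
    by (simp add: T.sum module_hom.sum[OF linear_P])
  also have "\<dots> = (\<Sum>l\<le>D. if theta D k = theta D l + c then P k (T (P l w)) else 0)"
    using P_other_weight[OF 1] by (intro sum.cong refl) auto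
  finally show "P k (T w) = \<dots>" .
qed

lemma P_shift:
  assumes "clinear T" "\<And>w. X (T w) = T (X w) + c *s T w" "theta D k = theta D l + c"
  shows "P k (T w) = T (P l w)"
proof -
  interpret T: module_hom "(*s)" "(*s)" T by fact
  have "P k (T (P l w)) = T (P l w)"
    using P_own_weight P_shift_gen(1)[OF assms(1,2), of l w] assms(3) by simp
  moreover have "theta D k = theta D l' + c \<longleftrightarrow> l' = l" for l'
    unfolding assms(3) by auto
  ultimately show ?thesis
    using P_shift_gen(2)[OF assms(1,2), of k w] P_eq_0[of l w] by auto
qed

text \<open>Since \<open>theta D l - 2 = theta D (Suc l)\<close>, such a \<open>T\<close> increases
  the index by 1 and never reaches index 0.\<close>

lemma P_lower_0:
  assumes "clinear T" "\<And>w. X (T w) = T (X w) - 2 *s T w"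
  shows "P 0 (T w) = 0"
proof -
  have "theta D 0 \<noteq> theta D l + - 2" for l
    using theta_Suc[of D l] theta_eq_iff[of D 0 "Suc l"] by simp
  moreover have "X (T w) = T (X w) + (- 2) *s T w" for w
    using assms(2) by (simp add: vec.scale_minus_left)
  ultimately show ?thesis
    using P_shift_gen(2)[OF assms(1), of "-2" 0 w] by simp
qed

lemma P_lagrange_op:
  "P l (lagrange_op D X k js w) = (\<Prod>j\<leftarrow>js. (theta D l - theta D j) / (theta D k - theta D j)) *s P l w"
  by (induction js) (simp_all add: P_simps P_X vec_eq_iff diff_divide_distrib algebra_simps)

text \<open>The Lagrange polynomial is 1 at \<open>theta D k\<close> and 0 at every other
  eigenvalue, so both sides have the same components. This gives invariance of subspaces under
  \<open>P k\<close> and identifies \<open>E_prim\<close>.\<close>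

lemma lagrange_op_eq: "lagrange_op D X k (filter (\<lambda>j. j \<noteq> k) [0..<Suc D]) w = P k w"
proof (rule eq_if_components_eq)
  fix l assume l: "l \<le> D"
  let ?js = "filter (\<lambda>j. j \<noteq> k) [0..<Suc D]"
  have "(\<Prod>j\<leftarrow>?js. (theta D l - theta D j) / (theta D k - theta D j)) = (if l = k then 1 else 0)"
  proof (cases "l = k")
    case True
    have "map (\<lambda>j. (theta D l - theta D j) / (theta D k - theta D j)) ?js = map (\<lambda>_. 1) ?js"
      using True by (intro map_cong refl) (auto simp del: upt_Suc)
    then show ?thesis using True by (simp add: map_replicate_const del: upt_Suc)
  next
    case False
    then have "l \<in> set ?js" using l by auto
    then have "0 \<in> set (map (\<lambda>j. (theta D l - theta D j) / (theta D k - theta D j)) ?js)"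
      unfolding set_map by (intro rev_image_eqI[of l]) simp_all
    then show ?thesis using False by (simp only: prod_list_zero_iff if_False)
  qed
  then show "P l (lagrange_op D X k ?js w) = P l (P k w)"
    unfolding P_lagrange_op by (simp add: P_P del: upt_Suc)
qed

lemma P_in_subspace:
  assumes "vec.subspace W" "\<And>w. w \<in> W \<Longrightarrow> X w \<in> W" "w \<in> W"
  shows "P k w \<in> W"
  unfolding lagrange_op_eq[of k w, symmetric] by (rule lagrange_op_in_subspace[OF assms])

lemma weights_iff:
  assumes "vec.subspace W" "\<And>w. w \<in> W \<Longrightarrow> X w \<in> W"
  shows "k \<in> weights D X W \<longleftrightarrow> k \<le> D \<and> (\<exists>w\<in>W. P k w \<noteq> 0)"
proof
  assume "k \<in> weights D X W"
  then obtain w where "k \<le> D" "w \<in> W" "w \<noteq> 0" "X w = theta D k *s w"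
    by (auto simp: weights_def)
  then show "k \<le> D \<and> (\<exists>w\<in>W. P k w \<noteq> 0)" using P_own_weight by metis
next
  assume "k \<le> D \<and> (\<exists>w\<in>W. P k w \<noteq> 0)"
  then obtain w where "k \<le> D" "w \<in> W" "P k w \<noteq> 0" by blast
  then show "k \<in> weights D X W"
    unfolding weights_def using P_in_subspace[OF assms] X_P by blast
qed

lemma weights_nonempty:
  assumes "vec.subspace W" "\<And>w. w \<in> W \<Longrightarrow> X w \<in> W" "w \<in> W" "w \<noteq> 0"
  shows "weights D X W \<noteq> {}"
  using weights_iff[OF assms(1,2)] assms(3,4) component_nonzero by (metis empty_iff)

text \<open>Translates the index set in \<open>module_endpoint\<close> and
  \<open>module_diameter\<close> into \<open>weights\<close>.\<close>

lemma weights_image: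
  assumes "vec.subspace W" "\<And>w. w \<in> W \<Longrightarrow> X w \<in> W"
  shows "{k. k \<le> D \<and> P k ` W \<noteq> {0}} = weights D X W"
proof -
  have "0 \<in> W" using assms(1) by (rule vec.subspace_0)
  then have "0 \<in> P k ` W" for k
    using P_simps(4)[of k] by (metis imageI)
  then have "P k ` W \<noteq> {0} \<longleftrightarrow> (\<exists>w\<in>W. P k w \<noteq> 0)" for k
    by blast
  then show ?thesis using weights_iff[OF assms] by (intro set_eqI) simp
qed

lemma neg_theta: "k \<le> D \<Longrightarrow> theta D (D - k) = - theta D k"
  by (simp add: theta_def of_nat_diff)

text \<open>Negation reverses the spectrum. The guard \<open>k \<le> D\<close> is there because
  truncated subtraction would send every larger index to 0.\<close>

lemma weight_operator_uminus:
  "weight_operator D (\<lambda>w. - X w) (\<lambda>k w. if k \<le> D then P (D - k) w else 0)"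
proof
  fix k v w
  show "- X (b1 + b2) = - X b1 + - X b2" "- X (r *s b1) = r *s - X b1" for r b1 b2
    by (simp_all add: X_simps vec.scale_minus_right)
  show "(if k \<le> D then P (D - k) (b1 + b2) else 0)
      = (if k \<le> D then P (D - k) b1 else 0) + (if k \<le> D then P (D - k) b2 else 0)"
    "(if k \<le> D then P (D - k) (r *s b1) else 0) = r *s (if k \<le> D then P (D - k) b1 else 0)" for r b1 b2
    by (simp_all add: P_simps)
  show "(if k \<le> D then P (D - k) (- X w) else 0) = theta D k *s (if k \<le> D then P (D - k) w else 0)"
    by (simp add: P_simps P_X neg_theta vec.scale_minus_left)
  show "- X (if k \<le> D then P (D - k) w else 0) = theta D k *s (if k \<le> D then P (D - k) w else 0)"
    by (simp add: X_P X_simps neg_theta vec.scale_minus_left)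
  have "(\<Sum>k\<le>D. if k \<le> D then P (D - k) w else 0) = (\<Sum>k\<le>D. P (D - k) w)"
    by (intro sum.cong) auto
  also have "\<dots> = (\<Sum>k\<le>D. P k w)"
    by (rule sum.reindex_bij_witness[of _ "\<lambda>k. D - k" "\<lambda>k. D - k"]) auto
  finally show "(\<Sum>k\<le>D. if k \<le> D then P (D - k) w else 0) = w"
    by (simp add: sum_P)
  show "herm (- X v) w = herm v (- X w)"
    using herm_X[of v w] by (simp add: herm_def sum_negf)
qed

lemma weights_uminus: "k \<le> D \<Longrightarrow> k \<in> weights D (\<lambda>w. - X w) W \<longleftrightarrow> D - k \<in> weights D X W"
proof -
  assume k: "k \<le> D"
  have "- X w = theta D k *s w \<longleftrightarrow> X w = theta D (D - k) *s w" for w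
    unfolding neg_theta[OF k] vec.scale_minus_left by (metis minus_minus)
  then show ?thesis using k by (auto simp: weights_def)
qed

end

section \<open>Cyclic triples\<close>

text \<open>Ladder operators for \<open>X\<close> in a triple \<open>(X, Y, Z)\<close>. The names
  refer to the eigenvalue, which changes by 2; the index moves by 1 in the opposite
  direction.\<close>

definition raise_op :: "('n::finite cvec \<Rightarrow> 'n cvec) \<Rightarrow> ('n cvec \<Rightarrow> 'n cvec) \<Rightarrow> 'n cvec \<Rightarrow> 'n cvec" where
  "raise_op Y Z w = Y w + \<i> *s Z w"

definition lower_op :: "('n::finite cvec \<Rightarrow> 'n cvec) \<Rightarrow> ('n cvec \<Rightarrow> 'n cvec) \<Rightarrow> 'n cvec \<Rightarrow> 'n cvec" where
  "lower_op Y Z w = Y w - \<i> *s Z w"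

lemma fst_eq_raise_lower: "Y w = (1 / 2) *s (raise_op Y Z w + lower_op Y Z w)"
  by (simp add: raise_op_def lower_op_def vec_eq_iff)

lemma snd_eq_raise_lower: "Z w = (- \<i> / 2) *s (raise_op Y Z w - lower_op Y Z w)"
  by (simp add: raise_op_def lower_op_def vec_eq_iff)

text \<open>The relations of \<open>sl_2\<close> in the cyclic form satisfied by the Pauli matrices;
  every lemma thus holds for the rotated triples too.\<close>

locale weight_triple =
  x: weight_operator D X PX + y: weight_operator D Y PY + z: weight_operator D Z PZ
  for D :: nat and X Y Z :: "'n::finite cvec \<Rightarrow> 'n cvec" and PX PY PZ +
  assumes comm_XY: "X (Y w) - Y (X w) = (2 * \<i>) *s Z w"
    and comm_YZ: "Y (Z w) - Z (Y w) = (2 * \<i>) *s X w"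
    and comm_ZX: "Z (X w) - X (Z w) = (2 * \<i>) *s Y w"
begin

lemma rotate: "weight_triple D Y Z X PY PZ PX"
  by unfold_locales (rule comm_XY comm_YZ comm_ZX)+

text \<open>Changing the signs of two of the three operators preserves all three relations. It
  exchanges the two ends of the spectrum of \<open>X\<close> and keeps \<open>Z\<close>.\<close>

lemma reflect: "weight_triple D (\<lambda>w. - X w) (\<lambda>w. - Y w) Z
    (\<lambda>k w. if k \<le> D then PX (D - k) w else 0) (\<lambda>k w. if k \<le> D then PY (D - k) w else 0) PZ"
proof (intro weight_triple.intro weight_triple_axioms.intro x.weight_operator_uminus y.weight_operator_uminus)
  show "weight_operator D Z PZ" ..
  fix w
  show "- X (- Y w) - - Y (- X w) = (2 * \<i>) *s Z w"
    using comm_XY[of w] by (simp add: x.X_simps y.X_simps)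
  have "- Y (Z w) - Z (- Y w) = - (Y (Z w) - Z (Y w))"
    by (simp add: z.X_simps)
  then show "- Y (Z w) - Z (- Y w) = (2 * \<i>) *s - X w"
    unfolding comm_YZ by (simp add: vec_eq_iff)
  have "Z (- X w) - - X (Z w) = - (Z (X w) - X (Z w))"
    by (simp add: z.X_simps)
  then show "Z (- X w) - - X (Z w) = (2 * \<i>) *s - Y w"
    unfolding comm_ZX by (simp add: vec_eq_iff)
qed

lemma linear_raise: "clinear (raise_op Y Z)"
  unfolding raise_op_def
  by unfold_locales (simp_all add: y.X_simps z.X_simps vec_eq_iff algebra_simps)

lemma linear_lower: "clinear (lower_op Y Z)"
  unfolding lower_op_def
  by unfold_locales (simp_all add: y.X_simps z.X_simps vec_eq_iff algebra_simps)

lemma XY_eq: "X (Y w) = Y (X w) + (2 * \<i>) *s Z w"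
  by (simp flip: comm_XY)

lemma XZ_eq: "X (Z w) = Z (X w) - (2 * \<i>) *s Y w"
  by (simp flip: comm_ZX)

lemma X_raise: "X (raise_op Y Z w) = raise_op Y Z (X w) + 2 *s raise_op Y Z w"
  unfolding raise_op_def by (simp add: x.X_simps XY_eq XZ_eq vec_eq_iff algebra_simps)

lemma X_lower: "X (lower_op Y Z w) = lower_op Y Z (X w) - 2 *s lower_op Y Z w"
  unfolding lower_op_def by (simp add: x.X_simps XY_eq XZ_eq vec_eq_iff algebra_simps)

lemma PX_raise: "PX k (raise_op Y Z w) = raise_op Y Z (PX (Suc k) w)"
  by (rule x.P_shift[OF linear_raise X_raise]) (simp add: theta_Suc)

lemma PX_lower: "PX (Suc k) (lower_op Y Z w) = lower_op Y Z (PX k w)"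
  by (rule x.P_shift[OF linear_lower, of "-2"]) (simp_all add: X_lower theta_Suc vec.scale_minus_left)

lemma PX_lower_0: "PX 0 (lower_op Y Z w) = 0"
  by (rule x.P_lower_0[OF linear_lower X_lower])

lemma raise_op_0:
  assumes "X w = theta D 0 *s w"
  shows "raise_op Y Z w = 0"
proof (rule x.outside_spectrum)
  show "X (raise_op Y Z w) = (theta D 0 + 2) *s raise_op Y Z w"
    unfolding X_raise assms module_hom.scale[OF linear_raise] by (simp add: vec.scale_left_distrib)
  show "theta D 0 + 2 \<noteq> theta D k" for k
    using theta_eq_iff[of D 0 "Suc k"] unfolding theta_Suc by (metis eq_diff_eq nat.distinct(1))
qed

section \<open>Components of a highest weight vector\<close>

context
  fixes u m
  assumes X_u: "X u = m *s u" and raise_u: "raise_op Y Z u = 0"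
begin

interpretation rot: weight_triple D Y Z X PY PZ PX by (rule rotate)

lemma Z_u: "Z u = \<i> *s Y u"
proof -
  have "\<i> *s raise_op Y Z u = 0" by (simp add: raise_u)
  then show ?thesis by (simp add: raise_op_def vec_eq_iff algebra_simps)
qed

text \<open>On \<open>u\<close> the operator \<open>Z + \<i> X\<close> equals
  \<open>\<i> (Y + m)\<close>, which is diagonal on \<open>Y\<close>-components; on the other hand
  it carries the component of index \<open>k + 1\<close> to index \<open>k\<close>.\<close>

lemma component_raise: "raise_op Z X (PY (Suc k) u) = (\<i> * (m + theta D k)) *s PY k u"
proof -
  have "raise_op Z X u = \<i> *s Y u + (\<i> * m) *s u"
    by (simp add: raise_op_def Z_u X_u)
  then have "PY k (raise_op Z X u) = PY k (\<i> *s Y u + (\<i> * m) *s u)"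
    by (rule arg_cong)
  also have "\<dots> = (\<i> * (m + theta D k)) *s PY k u"
    by (simp add: y.P_simps y.P_X vec_eq_iff algebra_simps)
  finally have "PY k (raise_op Z X u) = (\<i> * (m + theta D k)) *s PY k u" .
  then show ?thesis by (simp add: rot.PX_raise)
qed

lemma PY_lower: "PY k (lower_op Z X u) = (\<i> * (theta D k - m)) *s PY k u"
proof -
  have "lower_op Z X u = \<i> *s Y u - (\<i> * m) *s u"
    by (simp add: lower_op_def Z_u X_u)
  then have "PY k (lower_op Z X u) = PY k (\<i> *s Y u - (\<i> * m) *s u)"
    by (rule arg_cong)
  also have "\<dots> = (\<i> * (theta D k - m)) *s PY k u"
    by (simp add: y.P_simps y.P_X vec_eq_iff algebra_simps)
  finally show ?thesis .
qed

lemma component_lower: "lower_op Z X (PY k u) = (\<i> * (theta D (Suc k) - m)) *s PY (Suc k) u"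
  by (simp add: PY_lower flip: rot.PX_lower)

text \<open>The component of index \<open>k\<close> of \<open>Z u - \<i> X u\<close> can only come
  from index \<open>k - 1\<close>, where \<open>u\<close> has none; by \<open>PY_lower\<close> it is
  also \<open>\<i> (theta D k - m)\<close> times \<open>PY k u\<close>.\<close>

lemma lowest_component:
  assumes "PY k u \<noteq> 0" "\<And>l. l < k \<Longrightarrow> PY l u = 0"
  shows "theta D k = m"
proof -
  have "PY k (lower_op Z X u) = 0"
  proof (cases k)
    case 0
    then show ?thesis by (simp add: rot.PX_lower_0)
  next
    case (Suc l)
    then have "PY k (lower_op Z X u) = lower_op Z X 0"
      using assms(2)[of l] by (simp add: rot.PX_lower)
    then show ?thesis using module_hom.zero[OF rot.linear_lower] by simp
  qed
  then show ?thesis using assms(1) by (simp add: PY_lower)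
qed

lemma top_component_nonzero:
  assumes "u \<noteq> 0" "m = theta D r"
  shows "PY r u \<noteq> 0"
proof -
  define k where "k = (LEAST k. PY k u \<noteq> 0)"
  obtain l where "PY l u \<noteq> 0" using y.component_nonzero[OF assms(1)] .
  then have k: "PY k u \<noteq> 0" unfolding k_def by (rule LeastI)
  have "PY l u = 0" if "l < k" for l
    using not_less_Least[of l] that unfolding k_def by blast
  then have "k = r" using lowest_component[OF k] assms(2) by simp
  then show ?thesis using k by simp
qed

text \<open>\<open>X\<close> is a combination of \<open>Z + \<i> X\<close> and
  \<open>Z - \<i> X\<close>, each of which moves a component to one neighbour; hence the tridiagonal
  action.\<close>

lemma X_component: "X (PY (Suc k) u)
    = ((m + theta D k) / 2) *s PY k u + ((m - theta D (Suc (Suc k))) / 2) *s PY (Suc (Suc k)) u"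
  by (subst snd_eq_raise_lower[of X _ Z])
    (simp add: component_raise component_lower vec_eq_iff field_simps)

lemma Z_component: "Z (PY (Suc k) u)
    = (\<i> * (m + theta D k) / 2) *s PY k u - (\<i> * (m - theta D (Suc (Suc k))) / 2) *s PY (Suc (Suc k)) u"
  by (subst fst_eq_raise_lower[of Z _ X])
    (simp add: component_raise component_lower vec_eq_iff field_simps)

text \<open>Boundary case, in a form that also covers \<open>k = 0\<close>, where no neighbour of
  smaller index exists.\<close>

lemma component_first:
  assumes "raise_op Z X (PY k u) = 0"
  shows "X (PY k u) = ((m - theta D (Suc k)) / 2) *s PY (Suc k) u"
    and "Z (PY k u) = (- \<i> * (m - theta D (Suc k)) / 2) *s PY (Suc k) u"
  unfolding snd_eq_raise_lower[of X "PY k u" Z] fst_eq_raise_lower[of Z "PY k u" X]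
    assms component_lower by (simp_all add: vec_eq_iff field_simps)

end

end

section \<open>Invariant subspaces and their extreme weights\<close>

locale weight_module = weight_triple D X Y Z PX PY PZ
  for D :: nat and X Y Z :: "'n::finite cvec \<Rightarrow> 'n cvec" and PX PY PZ +
  fixes W :: "'n cvec set"
  assumes subspace_W: "vec.subspace W"
    and X_W: "w \<in> W \<Longrightarrow> X w \<in> W"
    and Y_W: "w \<in> W \<Longrightarrow> Y w \<in> W"
    and Z_W: "w \<in> W \<Longrightarrow> Z w \<in> W"
    and nonzero_W: "\<exists>w\<in>W. w \<noteq> 0"
begin

lemma rotate_module: "weight_module D Y Z X PY PZ PX W"
  by (intro weight_module.intro weight_module_axioms.intro rotate subspace_W X_W Y_W Z_W nonzero_W)

lemma reflect_module: "weight_module D (\<lambda>w. - X w) (\<lambda>w. - Y w) Z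
    (\<lambda>k w. if k \<le> D then PX (D - k) w else 0) (\<lambda>k w. if k \<le> D then PY (D - k) w else 0) PZ W"
  by (intro weight_module.intro weight_module_axioms.intro reflect subspace_W X_W Y_W Z_W nonzero_W
      vec.subspace_neg)

lemma weights_X_nonempty: "weights D X W \<noteq> {}"
  using nonzero_W x.weights_nonempty[OF subspace_W X_W] by blast

lemma Min_weights_in: "Min (weights D X W) \<in> weights D X W"
  by (rule Min_in[OF finite_weights weights_X_nonempty])

lemma PX_below: "w \<in> W \<Longrightarrow> k < Min (weights D X W) \<Longrightarrow> PX k w = 0"
  using x.weights_iff[OF subspace_W X_W, of k] Min_le[OF finite_weights, of k D X W] x.P_eq_0[of k w]
  by (meson leD not_le)

text \<open>Raising would produce a component of index \<open>r - 1\<close> of a vector of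
  \<open>W\<close>, below the minimum; for \<open>r = 0\<close> it would leave the spectrum.\<close>

lemma raise_highest:
  assumes "w \<in> W" "r = Min (weights D X W)"
  shows "raise_op Y Z (PX r w) = 0"
proof (cases r)
  case 0
  then show ?thesis using raise_op_0 x.X_P by simp
next
  case (Suc l)
  have "raise_op Y Z w \<in> W"
    unfolding raise_op_def using assms(1)
    by (intro vec.subspace_add vec.subspace_scale subspace_W Y_W Z_W)
  then have "PX l (raise_op Y Z w) = 0"
    using PX_below Suc assms(2) by simp
  then show ?thesis by (simp add: PX_raise Suc)
qed

lemma raise_highest_weight_vector:
  assumes "w \<in> W" "X w = theta D (Min (weights D X W)) *s w"
  shows "raise_op Y Z w = 0"
  using raise_highest[OF assms(1) refl] x.P_own_weight[OF assms(2)] by simp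

text \<open>A highest \<open>X\<close>-eigenvector has a nonzero \<open>Y\<close>-component for the
  same eigenvalue, by \<open>top_component_nonzero\<close>.\<close>

lemma Min_weights_in_Y: "Min (weights D X W) \<in> weights D Y W"
proof -
  let ?r = "Min (weights D X W)"
  obtain u where u: "u \<in> W" "u \<noteq> 0" "X u = theta D ?r *s u"
    using Min_weights_in unfolding weights_def by blast
  have "PY ?r u \<noteq> 0"
    using top_component_nonzero[OF u(3) raise_highest_weight_vector[OF u(1,3)] u(2)] by simp
  then show ?thesis
    using y.weights_iff[OF subspace_W Y_W] u(1) y.P_eq_0[of ?r u] by (meson not_le)
qed

lemma Min_weights_Y_le: "Min (weights D Y W) \<le> Min (weights D X W)"
  by (rule Min_le[OF finite_weights Min_weights_in_Y])

end

context weight_module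
begin

interpretation rot: weight_module D Y Z X PY PZ PX W by (rule rotate_module)
interpretation rot2: weight_module D Z X Y PZ PX PY W by (rule rot.rotate_module)

text \<open>The inequality \<open>Min_weights_Y_le\<close>, taken once around the cycle of three
  operators, forces equality.\<close>

lemma Min_weights_Y: "Min (weights D Y W) = Min (weights D X W)"
  using Min_weights_Y_le rot.Min_weights_Y_le rot2.Min_weights_Y_le by linarith

end

context weight_module
begin

interpretation rot: weight_module D Y Z X PY PZ PX W by (rule rotate_module)

lemma Min_weights_Z: "Min (weights D Z W) = Min (weights D X W)"
  using rot.Min_weights_Y Min_weights_Y by simp

end

context weight_module
begin

interpretation refl: weight_module D "\<lambda>w. - X w" "\<lambda>w. - Y w" Z
    "\<lambda>k w. if k \<le> D then PX (D - k) w else 0" "\<lambda>k w. if k \<le> D then PY (D - k) w else 0" PZ W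
  by (rule reflect_module)

lemma weights_X_bounds:
  assumes "k \<in> weights D X W"
  shows "Min (weights D X W) \<le> k" "k \<le> D - Min (weights D X W)"
proof -
  show "Min (weights D X W) \<le> k" using assms by (simp add: finite_weights)
  have "k \<le> D" using assms by (simp add: weights_def)
  then have "D - k \<in> weights D (\<lambda>w. - X w) W"
    using assms by (simp add: x.weights_uminus)
  then have "Min (weights D (\<lambda>w. - X w) W) \<le> D - k" by (simp add: finite_weights)
  \<comment> \<open>The original and the reflected triple share \<open>Z\<close>, so
    \<open>X\<close> and \<open>-X\<close> have the same minimal index.\<close>
  then have "Min (weights D X W) \<le> D - k"
    using refl.Min_weights_Z Min_weights_Z by simp
  then show "k \<le> D - Min (weights D X W)" using \<open>k \<le> D\<close> by linarith
qed

lemma double_endpoint_le: "2 * Min (weights D X W) \<le> D"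
  using weights_X_bounds[OF Min_weights_in] Min_weights_in by (auto simp: weights_def)

end

section \<open>The full set of weights and the inner products of components\<close>

context weight_module
begin

interpretation rot: weight_module D Y Z X PY PZ PX W by (rule rotate_module)
interpretation rot2: weight_module D Z X Y PZ PX PY W by (rule rot.rotate_module)

lemma weights_Y_eq:
  assumes r: "r = Min (weights D X W)"
  shows "weights D Y W = {r..D - r}"
proof
  show "weights D Y W \<subseteq> {r..D - r}"
    using rot.weights_X_bounds Min_weights_Y r by auto
  obtain u where u: "u \<in> W" "u \<noteq> 0" "X u = theta D r *s u"
    using Min_weights_in r unfolding weights_def by blast
  have raise_u: "raise_op Y Z u = 0"
    using raise_highest_weight_vector u r by simp
  have nz: "PY (r + k) u \<noteq> 0" if "k \<le> D - 2 * r" for k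
    using that
  proof (induction k)
    case 0
    show ?case using top_component_nonzero[OF u(3) raise_u u(2)] by simp
  next
    case (Suc k)
    \<comment> \<open>This factor of \<open>component_raise\<close> equals
      \<open>2 (D - 2r - k)\<close>, so the components of \<open>u\<close> cannot vanish before
      index \<open>D - r\<close> is passed.\<close>
    have "theta D r + theta D (r + k) \<noteq> 0"
    proof -
      define e where "e = D - 2 * r - Suc k"
      then have e: "D = 2 * r + k + Suc e" using Suc.prems by simp
      have "theta D r + theta D (r + k) = 2 * of_nat (Suc e)"
        by (simp add: theta_def e algebra_simps)
      then show ?thesis by (metis mult_eq_0_iff of_nat_eq_0_iff nat.distinct(1) zero_neq_numeral)
    qed
    then have "raise_op Z X (PY (Suc (r + k)) u) \<noteq> 0"
      using Suc component_raise[OF u(3) raise_u, of "r + k"] by simp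
    then show ?case using module_hom.zero[OF rot.linear_raise] by auto
  qed
  show "{r..D - r} \<subseteq> weights D Y W"
  proof
    fix k assume k: "k \<in> {r..D - r}"
    then have "PY (r + (k - r)) u \<noteq> 0" by (intro nz) auto
    then show "k \<in> weights D Y W"
      using k u(1) y.weights_iff[OF subspace_W Y_W] by auto
  qed
qed

text \<open>Here \<open>v\<close> is a highest vector for \<open>Z\<close>, split by
  \<open>X\<close>, and \<open>u\<close> is one for \<open>X\<close>, split by \<open>Y\<close>.
  Self-adjointness of \<open>X\<close> gives a recurrence in \<open>j\<close>, that of
  \<open>Y\<close> one in \<open>i\<close>.\<close>

lemma inner_product_components:
  assumes r: "r = Min (weights D X W)" and d: "d = D - 2 * r" and i: "i \<le> d"
    and v: "v \<in> W" "Z v = theta D r *s v" and u: "u \<in> W" "X u = theta D r *s u"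
  shows "herm (PX (r + i) v) (PY (r + j) u)
    = \<i> ^ i * (1 / 2 ^ d) * herm v u * of_nat (d choose i) * coeff (krawtchouk_gf d i) j"
proof -
  have D: "of_nat D = of_nat d + 2 * (of_nat r :: complex)"
    using double_endpoint_le r d by (simp add: of_nat_diff)
  \<comment> \<open>After the shift by \<open>r\<close> the eigenvalues are those of a
    \<open>d\<close>-cube.\<close>
  have th: "theta D (r + k) = of_nat d - 2 * of_nat k" "theta D r = of_nat d" for k
    by (simp_all add: theta_def D)
  have coeffs: "(of_nat d + theta D (r + k)) / 2 = of_nat d - of_nat k"
    "(of_nat d - theta D (Suc (Suc (r + k)))) / 2 = of_nat (k + 2)" for k
    using th(1)[of k] th(1)[of "k + 2"] by (simp_all add: field_simps)
  have raise_u: "raise_op Y Z u = 0"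
    using raise_highest_weight_vector u r by simp
  have raise_v: "raise_op X Y v = 0"
    using rot2.raise_highest_weight_vector v r Min_weights_Z by simp
  have "raise_op Z X (PY r u) = 0"
    using rot.raise_highest u r Min_weights_Y by simp
  from component_first(1)[OF u(2) raise_u this] th(1)[of 1]
  have X_0: "X (PY r u) = PY (r + 1) u"
    by (simp add: th(2))
  have X_Suc: "X (PY (r + Suc k) u)
      = (of_nat d - of_nat k) *s PY (r + k) u + of_nat (k + 2) *s PY (r + (k + 2)) u" for k
    using X_component[OF u(2) raise_u, of "r + k"] unfolding th(2) coeffs by simp
  \<comment> \<open>For \<open>v\<close> the triple is \<open>(Z, X, Y)\<close>: its components are
    taken by \<open>X\<close>, and \<open>Y\<close> is the third operator, which brings in the
    factors \<open>\<i>\<close>.\<close>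
  have "raise_op Y Z (PX r v) = 0"
    using raise_highest v r by simp
  from rot2.component_first(2)[OF v(2) raise_v this] th(1)[of 1]
  have Y_0: "Y (PX r v) = (- \<i>) *s PX (r + 1) v"
    by (simp add: th(2))
  have Y_Suc: "Y (PX (r + Suc k) v)
      = (\<i> * (of_nat d - of_nat k)) *s PX (r + k) v - (\<i> * of_nat (k + 2)) *s PX (r + (k + 2)) v" for k
    using rot2.Z_component[OF v(2) raise_v, of "r + k"]
    unfolding th(2) times_divide_eq_right[symmetric] coeffs by simp

  define f where "f i j = herm (PX (r + i) v) (PY (r + j) u)" for i j
  have f_1: "f i 1 = (of_nat d - 2 * of_nat i) * f i 0" for i
    using x.herm_X[of "PX (r + i) v" "PY r u"]
    by (simp only: f_def X_0 x.X_P herm_scale_left th(1) add_0_right)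
  have f_Suc: "of_nat (j + 2) * f i (j + 2) + (of_nat d - of_nat j) * f i j
      = (of_nat d - 2 * of_nat i) * f i (Suc j)" for i j
    using x.herm_X[of "PX (r + i) v" "PY (r + Suc j) u"]
    by (simp only: f_def X_Suc x.X_P herm_scale_left herm_scale_right herm_add_right th(1)) simp
  \<comment> \<open>The factor \<open>- \<i>\<close> stands in the first argument of
    \<open>herm\<close> and is not conjugated.\<close>
  have f_col_1: "f 1 0 = \<i> * of_nat d * f 0 0"
  proof -
    have "- \<i> * f 1 0 = of_nat d * f 0 0"
      using y.herm_X[of "PX r v" "PY r u"]
      by (simp only: f_def Y_0 y.X_P herm_scale_left herm_scale_right th(2) add_0_right) simp
    from arg_cong[OF this, of "\<lambda>a. \<i> * a"] show ?thesis by simp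
  qed
  have f_col_Suc: "of_nat (i + 2) * f (i + 2) 0 = (of_nat d - of_nat i) * f i 0 + \<i> * of_nat d * f (Suc i) 0" for i
  proof -
    have "\<i> * (of_nat d - of_nat i) * f i 0 - \<i> * of_nat (i + 2) * f (i + 2) 0 = of_nat d * f (Suc i) 0"
      using y.herm_X[of "PX (r + Suc i) v" "PY r u"]
      by (simp only: f_def Y_Suc y.X_P herm_scale_left herm_scale_right herm_diff_left th(2) add_0_right) simp
    from arg_cong[OF this, of "\<lambda>a. \<i> * a"] show ?thesis
      by (simp add: algebra_simps)
  qed
  have row: "f i j = f i 0 * coeff (krawtchouk_gf d i) j" if "i \<le> d" for i j
  proof (induction j rule: induct_nat_012)
    case 0
    show ?case by (simp add: krawtchouk_gf_coeff_0)
  next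
    case 1
    show ?case using f_1[of i] krawtchouk_gf_coeff_1[OF that] by simp
  next
    case (ge2 j)
    let ?c = "coeff (krawtchouk_gf d i)"
    have "of_nat (j + 2) * f i (j + 2) = f i 0 * ((of_nat d - 2 * of_nat i) * ?c (Suc j) - (of_nat d - of_nat j) * ?c j)"
      using f_Suc[of j i] ge2 by (simp add: algebra_simps)
    also have "\<dots> = f i 0 * (of_nat (j + 2) * ?c (Suc (Suc j)))"
      unfolding krawtchouk_gf_coeff_Suc[OF that, of j, symmetric] by simp
    finally have "of_nat (j + 2) * f i (j + 2) = of_nat (j + 2) * (f i 0 * ?c (Suc (Suc j)))"
      by simp
    then show ?case unfolding mult_cancel_left of_nat_eq_0_iff by simp
  qed
  have absorb: "of_nat (Suc k) * of_nat (d choose Suc k) = (of_nat d - of_nat k) * (of_nat (d choose k) :: complex)" for k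
  proof (cases "k \<le> d")
    case True
    have "Suc k * (d choose Suc k) = (d - k) * (d choose k)"
      by (simp only: binomial_absorption binomial_absorb_comp)
    from arg_cong[OF this, of "of_nat :: nat \<Rightarrow> complex"] show ?thesis
      by (simp only: of_nat_mult of_nat_diff[OF True])
  qed (simp add: binomial_eq_0)
  have column: "f i 0 = \<i> ^ i * of_nat (d choose i) * f 0 0" for i
  proof (induction i rule: induct_nat_012)
    case 0
    show ?case by simp
  next
    case 1
    show ?case using f_col_1 by simp
  next
    case (ge2 i)
    let ?b = "\<lambda>k. of_nat (d choose k) :: complex"
    have "of_nat (i + 2) * f (i + 2) 0
        = \<i> ^ i * f 0 0 * ((of_nat d - of_nat i) * ?b i - of_nat d * ?b (Suc i))"
      unfolding f_col_Suc ge2 by (simp add: algebra_simps)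
    \<comment> \<open>Absorption turns \<open>(d - i) (d choose i)\<close> into
      \<open>(i + 1) (d choose (i + 1))\<close>. A second absorption yields
      \<open>- (i + 2) (d choose (i + 2))\<close>, whose sign is \<open>\<i>^2\<close>.\<close>
    also have "\<dots> = \<i> ^ i * f 0 0 * (- (of_nat d - of_nat (Suc i)) * ?b (Suc i))"
      unfolding absorb[symmetric] by (simp add: algebra_simps)
    also have "- (of_nat d - of_nat (Suc i)) * ?b (Suc i) = - (of_nat (Suc (Suc i)) * ?b (Suc (Suc i)))"
      by (simp only: absorb minus_mult_left)
    also have "\<i> ^ i * f 0 0 * - (of_nat (Suc (Suc i)) * ?b (Suc (Suc i)))
        = of_nat (i + 2) * (\<i> ^ (i + 2) * ?b (i + 2) * f 0 0)"
      by simp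
    finally show ?case unfolding mult_cancel_left of_nat_eq_0_iff by simp
  qed
  define a where "a = f 0 0"
  have row_0: "f 0 j = a * of_nat (d choose j)" for j
    using row[of 0 j] by (simp add: a_def krawtchouk_gf_def coeff_one_plus_power)
  \<comment> \<open>Row 0 determines the constant: \<open>u\<close> is an
    \<open>X\<close>-eigenvector of index \<open>r\<close>, so it sees only \<open>PX r v\<close>,
    and the binomial row sums to \<open>2^d\<close>.\<close>
  have "herm v u = herm (PX r v) u"
    by (simp add: x.herm_P x.P_own_weight u)
  also have "\<dots> = (\<Sum>k\<le>D. herm (PX r v) (PY k u))"
    by (simp add: y.sum_P flip: herm_sum_right)
  also have "\<dots> = (\<Sum>k\<in>{r..D}. herm (PX r v) (PY k u))"
    using rot.PX_below[OF u(1)] Min_weights_Y r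
    by (intro sum.mono_neutral_right) (auto simp: herm_zero_right)
  also have "\<dots> = (\<Sum>j\<le>D - r. f 0 j)"
    using double_endpoint_le r unfolding f_def
    by (intro sum.reindex_bij_witness[of _ "\<lambda>j. r + j" "\<lambda>k. k - r"]) auto
  also have "\<dots> = (\<Sum>j\<le>d. f 0 j)"
    using double_endpoint_le r d by (intro sum.mono_neutral_right) (auto simp: row_0 binomial_eq_0)
  also have "\<dots> = a * of_nat (\<Sum>j\<le>d. d choose j)"
    by (simp only: row_0 of_nat_sum sum_distrib_left)
  finally have "f 0 0 = herm v u * (1 / 2 ^ d)"
    by (simp add: choose_row_sum a_def)
  then have "f i j = \<i> ^ i * (1 / 2 ^ d) * herm v u * of_nat (d choose i) * coeff (krawtchouk_gf d i) j"
    using row[OF i, of j] column[of i] by (simp add: algebra_simps)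
  then show ?thesis by (simp add: f_def)
qed

end

section \<open>The cube\<close>

definition flip_at :: "'n::finite \<Rightarrow> 'n vertex \<Rightarrow> 'n vertex" where
  "flip_at k z = (\<chi> l. if l = k then \<not> z $ l else z $ l)"

lemma flip_nth: "flip_at k z $ l = (if l = k then \<not> z $ l else z $ l)"
  by (simp add: flip_at_def)

lemma inj_flip: "inj (\<lambda>k. flip_at k z)"
  by (rule injI) (metis flip_nth)

lemma cube_adj_sym: "cube_adj y z = cube_adj z y"
  by (simp add: cube_adj_def eq_commute)

lemma cube_adj_flip: "cube_adj y (flip_at k y)"
proof -
  have "{l. y $ l \<noteq> flip_at k y $ l} = {k}" by (auto simp: flip_nth)
  then show ?thesis by (simp add: cube_adj_def)
qed

lemma cube_adj_iff: "cube_adj y z \<longleftrightarrow> z \<in> range (\<lambda>k. flip_at k y)"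
proof
  assume "cube_adj y z"
  then obtain k where k: "{l. y $ l \<noteq> z $ l} = {k}"
    unfolding cube_adj_def by (meson card_1_singletonE)
  have "z $ l = flip_at k y $ l" for l
    using k by (cases "l = k") (auto simp: flip_nth)
  then have "z = flip_at k y" by (simp add: vec_eq_iff)
  then show "z \<in> range (\<lambda>k. flip_at k y)" by blast
qed (auto simp: cube_adj_flip)

lemma sum_cube_adj:
  fixes g :: "'n::finite vertex \<Rightarrow> 'a::comm_monoid_add"
  shows "(\<Sum>z\<in>UNIV. if cube_adj y z then g z else 0) = (\<Sum>k\<in>UNIV. g (flip_at k y))"
proof -
  have "(\<Sum>z\<in>UNIV. if cube_adj y z then g z else 0) = (\<Sum>z\<in>range (\<lambda>k. flip_at k y). g z)"
    by (rule sum.mono_neutral_cong_right) (auto simp: cube_adj_iff)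
  also have "\<dots> = (\<Sum>k\<in>UNIV. g (flip_at k y))"
    by (subst sum.reindex) (simp_all add: inj_flip o_def)
  finally show ?thesis .
qed

lemma cube_adj_weight:
  assumes "cube_adj y z"
  shows "card {k. z $ k} \<le> Suc (card {k. y $ k})"
proof -
  obtain k where k: "z = flip_at k y" using assms by (auto simp: cube_adj_iff)
  have "card {l. z $ l} \<le> card (insert k {l. y $ l})"
    unfolding k by (rule card_mono) (auto simp: flip_nth split: if_splits)
  also have "\<dots> \<le> Suc (card {l. y $ l})" by (simp add: card_insert_if)
  finally show ?thesis .
qed

lemma cube_walk_weight:
  "(cube_adj ^^ n) base_vertex y \<Longrightarrow> card {k. y $ k} \<le> n"
proof (induction n arbitrary: y)
  case 0
  then show ?case by (auto simp: base_vertex_def)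
next
  case (Suc n)
  then obtain w where "(cube_adj ^^ n) base_vertex w" "cube_adj w y" by auto
  with Suc.IH[of w] cube_adj_weight[of w y] show ?case by simp
qed

text \<open>Clearing one \<open>True\<close> coordinate gives a neighbour of weight one less, from
  which the walk is continued.\<close>

lemma cube_walk_exists:
  "card {k. y $ k} = n \<Longrightarrow> (cube_adj ^^ n) base_vertex y"
proof (induction n arbitrary: y)
  case 0
  then have "\<not> y $ k" for k by auto
  then have "y = base_vertex" by (simp add: base_vertex_def vec_eq_iff)
  then show ?case by simp
next
  case (Suc n)
  then have "{k. y $ k} \<noteq> {}" by (metis card.empty nat.distinct(1))
  then obtain k where k: "y $ k" by auto
  have "{l. flip_at k y $ l} = {l. y $ l} - {k}" using k by (auto simp: flip_nth)
  then have "card {l. flip_at k y $ l} = n" using Suc.prems k by simp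
  moreover have "cube_adj (flip_at k y) y" using cube_adj_flip cube_adj_sym by blast
  ultimately show ?case using Suc.IH by auto
qed

lemma cube_dist_base: "cube_dist base_vertex y = card {k. y $ k}"
  unfolding cube_dist_def by (rule Least_equality) (simp_all add: cube_walk_exists cube_walk_weight)

lemma cube_dist_base_le: "cube_dist base_vertex (y :: 'n::finite vertex) \<le> CARD('n)"
  unfolding cube_dist_base by (rule card_mono) auto

definition bit_sign :: "bool \<Rightarrow> complex" where
  "bit_sign b = (if b then -1 else 1)"

text \<open>Exhibits the diagonal of \<open>A\<^sup>*\<close> as a sum over coordinates, of which a
  flip changes a single summand.\<close>

lemma theta_cube_dist:
  "theta CARD('n) (cube_dist base_vertex y) = (\<Sum>k\<in>UNIV. bit_sign (y $ k))" for y :: "'n::finite vertex"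
proof -
  have "(\<Sum>k\<in>UNIV. bit_sign (y $ k)) = (\<Sum>k\<in>UNIV. 1 - 2 * (if y $ k then 1 else 0))"
    by (intro sum.cong refl) (simp add: bit_sign_def)
  also have "\<dots> = of_nat CARD('n) - 2 * of_nat (card {k. y $ k})"
    by (simp add: sum_subtractf sum.If_cases flip: sum_distrib_left)
  finally show ?thesis by (simp add: theta_def cube_dist_base)
qed

lemma sum_bit_sign_flip:
  "(\<Sum>l\<in>UNIV. bit_sign (flip_at k y $ l)) = (\<Sum>l\<in>UNIV. bit_sign (y $ l)) - 2 * bit_sign (y $ k)"
proof -
  have "(\<Sum>l\<in>UNIV. bit_sign (flip_at k y $ l)) = (\<Sum>l\<in>UNIV. bit_sign (y $ l) - (if l = k then 2 * bit_sign (y $ k) else 0))"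
    by (intro sum.cong refl) (simp add: flip_nth bit_sign_def)
  then show ?thesis by (simp add: sum_subtractf)
qed

section \<open>The three cube matrices and their cyclic symmetry\<close>

definition cube_Aeps :: "'n::finite cmat" where
  "cube_Aeps = mscale (- \<i> / 2) (cube_A ** cube_Astar - cube_Astar ** cube_A)"

lemma cube_Astar_mult: "(M ** cube_Astar) $ y $ z = M $ y $ z * (\<Sum>k\<in>UNIV. bit_sign (z $ k))"
  by (simp add: matrix_matrix_mult_def cube_Astar_def theta_cube_dist if_distrib cong: if_cong)

lemma mult_cube_Astar: "(cube_Astar ** M) $ y $ z = (\<Sum>k\<in>UNIV. bit_sign (y $ k)) * M $ y $ z"
  by (simp add: matrix_matrix_mult_def cube_Astar_def theta_cube_dist if_distrib if_distribR cong: if_cong)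

lemma cube_Aeps_nth:
  "cube_Aeps $ y $ z = (if cube_adj y z
     then - \<i> / 2 * ((\<Sum>k\<in>UNIV. bit_sign (z $ k)) - (\<Sum>k\<in>UNIV. bit_sign (y $ k))) else 0)"
  unfolding cube_Aeps_def mscale_def by (simp add: cube_Astar_mult mult_cube_Astar) (simp add: cube_A_def)

lemma mult_cube_A: "(M ** cube_A) $ y $ z = (\<Sum>k\<in>UNIV. M $ y $ flip_at k z)"
  by (simp add: matrix_matrix_mult_def cube_A_def if_distrib cube_adj_sym[of _ z] sum_cube_adj cong: if_cong)

lemma cube_A_mult: "(cube_A ** M) $ y $ z = (\<Sum>k\<in>UNIV. M $ flip_at k y $ z)"
  by (simp add: matrix_matrix_mult_def cube_A_def if_distrib[of "\<lambda>a. a * _"] sum_cube_adj cong: if_cong)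

lemma mult_cube_Aeps: "(M ** cube_Aeps) $ y $ z = (\<Sum>k\<in>UNIV. M $ y $ flip_at k z * (- \<i> * bit_sign (z $ k)))"
  by (simp add: matrix_matrix_mult_def cube_Aeps_nth if_distrib cube_adj_sym[of _ z] sum_cube_adj
      sum_bit_sign_flip cong: if_cong)

lemma cube_Aeps_mult: "(cube_Aeps ** M) $ y $ z = (\<Sum>k\<in>UNIV. \<i> * bit_sign (y $ k) * M $ flip_at k y $ z)"
  by (simp add: matrix_matrix_mult_def cube_Aeps_nth if_distrib[of "\<lambda>a. a * _"] sum_cube_adj
      sum_bit_sign_flip mult.assoc cong: if_cong)

lemma cube_P_flip_right: "cube_P $ y $ flip_at k z = bit_sign (y $ k) * cube_P $ y $ z"
proof -
  have "(\<Prod>l\<in>UNIV. P1 (y $ l) (flip_at k z $ l)) = (\<Prod>l\<in>UNIV. (if l = k then bit_sign (y $ k) else 1) * P1 (y $ l) (z $ l))"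
    by (intro prod.cong refl) (simp add: flip_nth P1_def bit_sign_def)
  then show ?thesis by (simp add: cube_P_def prod.distrib)
qed

lemma cube_P_flip_left: "cube_P $ flip_at k y $ z = - \<i> * bit_sign (y $ k) * bit_sign (z $ k) * cube_P $ y $ z"
proof -
  have "(\<Prod>l\<in>UNIV. P1 (flip_at k y $ l) (z $ l)) = (\<Prod>l\<in>UNIV. (if l = k then - \<i> * bit_sign (y $ k) * bit_sign (z $ k) else 1) * P1 (y $ l) (z $ l))"
    by (intro prod.cong refl) (simp add: flip_nth P1_def bit_sign_def)
  then show ?thesis by (simp add: cube_P_def prod.distrib)
qed

text \<open>First of three intertwining relations: conjugation by \<open>cube_P\<close> takes
  \<open>cube_A\<close> to \<open>cube_Astar\<close>, this to \<open>cube_Aeps\<close>, and that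
  back to \<open>cube_A\<close>.\<close>

lemma cube_P_A: "cube_P ** cube_A = cube_Astar ** cube_P"
  by (simp add: vec_eq_iff mult_cube_A mult_cube_Astar cube_P_flip_right sum_distrib_right)

lemma cube_P_Aeps: "cube_P ** cube_Aeps = cube_A ** cube_P"
  by (simp add: vec_eq_iff mult_cube_Aeps cube_A_mult cube_P_flip_right cube_P_flip_left algebra_simps)

lemma cube_P_Astar: "cube_P ** cube_Astar = cube_Aeps ** cube_P"
proof -
  have "\<i> * bit_sign a * (- \<i> * bit_sign a * b * c) = c * b" for a b c
    by (simp add: bit_sign_def flip: mult.assoc)
  then show ?thesis
    by (simp add: vec_eq_iff cube_Astar_mult cube_Aeps_mult cube_P_flip_left sum_distrib_left)
qed

lemma sum_vec_prod:
  fixes f :: "'n::finite \<Rightarrow> 'b::finite \<Rightarrow> 'c::comm_semiring_1"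
  shows "(\<Sum>z\<in>(UNIV :: ('b ^ 'n) set). \<Prod>k\<in>UNIV. f k (z $ k)) = (\<Prod>k\<in>UNIV. \<Sum>b\<in>UNIV. f k b)"
proof -
  have "bij_betw vec_lambda (UNIV :: ('n \<Rightarrow> 'b) set) UNIV"
    by (metis bij_betw_def inj_on_def surj_def vec_lambda_inverse UNIV_I vec_nth_inverse)
  then have "(\<Sum>z\<in>UNIV. \<Prod>k\<in>UNIV. f k (z $ k)) = (\<Sum>g\<in>UNIV. \<Prod>k\<in>UNIV. f k (g k))"
    by (subst sum.reindex_bij_betw[symmetric]) auto
  also have "\<dots> = (\<Prod>k\<in>UNIV. \<Sum>b\<in>UNIV. f k b)"
    by (subst prod_sum_PiE) (auto simp: PiE_UNIV_domain)
  finally show ?thesis .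
qed

lemma invertible_cube_P: "invertible (cube_P :: 'n::finite cmat)"
proof -
  \<comment> \<open>The rows of \<open>P1\<close> are orthogonal of squared length 2, so its inverse
    is half the conjugate transpose; \<open>?Q\<close> is the Kronecker power of that.\<close>
  let ?Q = "\<chi> z y. (\<Prod>k\<in>UNIV. cnj (P1 (y $ k) (z $ k)) / 2) :: 'n cmat"
  have 1: "(\<Sum>c\<in>UNIV. P1 a c * cnj (P1 b c) / 2) = (if a = b then 1 else 0)" for a b
    by (simp add: UNIV_bool P1_def)
  have "(cube_P ** ?Q) $ y $ y' = mat 1 $ y $ y'" for y y'
  proof -
    have "(cube_P ** ?Q) $ y $ y' = (\<Sum>z\<in>UNIV. \<Prod>k\<in>UNIV. P1 (y $ k) (z $ k) * (cnj (P1 (y' $ k) (z $ k)) / 2))"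
      by (simp add: matrix_matrix_mult_def cube_P_def flip: prod.distrib)
    also have "\<dots> = (\<Prod>k\<in>UNIV. if y $ k = y' $ k then 1 else 0)"
      by (subst sum_vec_prod) (simp add: 1)
    also have "\<dots> = mat 1 $ y $ y'"
      by (auto simp: mat_def vec_eq_iff)
    finally show ?thesis .
  qed
  then have "cube_P ** ?Q = mat 1" by (simp add: vec_eq_iff)
  then show ?thesis unfolding invertible_def using matrix_left_right_inverse by blast
qed

lemma clinear_matrix: "clinear ((*v) M)"
  using matrix_vector_mul_linear_gen by (simp add: linear_iff_module_hom)

lemma herm_matrix:
  fixes M :: "'n::finite cmat"
  assumes "\<And>y z. M $ y $ z = cnj (M $ z $ y)"
  shows "herm (M *v v) w = herm v (M *v w)"
proof -
  have "herm (M *v v) w = (\<Sum>y\<in>UNIV. \<Sum>z\<in>UNIV. M $ y $ z * v $ z * cnj (w $ y))"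
    by (simp add: herm_def matrix_vector_mult_def sum_distrib_right)
  also have "\<dots> = (\<Sum>z\<in>UNIV. \<Sum>y\<in>UNIV. M $ y $ z * v $ z * cnj (w $ y))"
    by (rule sum.swap)
  also have "\<dots> = (\<Sum>z\<in>UNIV. \<Sum>y\<in>UNIV. v $ z * cnj (M $ z $ y * w $ y))"
    by (intro sum.cong refl, subst assms) (simp add: mult_ac)
  also have "\<dots> = herm v (M *v w)"
    by (simp add: herm_def matrix_vector_mult_def sum_distrib_left)
  finally show ?thesis .
qed

lemma herm_cube_A: "herm (cube_A *v v) w = herm v (cube_A *v w)"
  by (rule herm_matrix) (simp add: cube_A_def cube_adj_sym)

lemma herm_cube_Astar: "herm (cube_Astar *v v) w = herm v (cube_Astar *v w)"
  by (rule herm_matrix) (simp add: cube_Astar_def)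

lemma herm_cube_Aeps: "herm (cube_Aeps *v v) w = herm v (cube_Aeps *v w)"
proof (rule herm_matrix)
  fix y z :: "'a vertex"
  have "cnj (\<Sum>k\<in>UNIV. bit_sign (x $ k)) = (\<Sum>k\<in>UNIV. bit_sign (x $ k))" for x :: "'a vertex"
    unfolding cnj_sum by (intro sum.cong refl) (simp add: bit_sign_def)
  then show "cube_Aeps $ y $ z = cnj (cube_Aeps $ z $ y)"
    by (simp add: cube_Aeps_nth cube_adj_sym[of z y] algebra_simps diff_divide_distrib del: cnj_sum)
qed

text \<open>Spectral projections are transported along a similarity. As \<open>p\<close> need not be
  unitary, self-adjointness of \<open>X\<close> is a separate assumption.\<close>

lemma weight_operator_conj:
  assumes "weight_operator D Y Q" "clinear X" "\<And>v w. herm (X v) w = herm v (X w)"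
    and "clinear p" "clinear q" "\<And>w. q (p w) = w" "\<And>w. p (q w) = w"
    and pX: "\<And>w. p (X w) = Y (p w)"
  shows "weight_operator D X (\<lambda>k w. q (Q k (p w)))"
proof -
  interpret Y: weight_operator D Y Q by fact
  note p_simps = module_hom.add[OF assms(4)] module_hom.scale[OF assms(4)]
  note q_simps = module_hom.add[OF assms(5)] module_hom.scale[OF assms(5)]
  show ?thesis
  proof (intro weight_operator.intro assms(2,3))
    fix k w
    show "clinear (\<lambda>w. q (Q k (p w)))"
      by unfold_locales (simp_all add: p_simps q_simps Y.P_simps)
    show "q (Q k (p (X w))) = theta D k *s q (Q k (p w))"
      by (simp add: pX Y.P_X q_simps)
    have "p (X (q (Q k (p w)))) = theta D k *s Q k (p w)"
      by (simp add: pX assms(7) Y.X_P)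
    then have "q (p (X (q (Q k (p w))))) = theta D k *s q (Q k (p w))"
      by (simp only: q_simps)
    then show "X (q (Q k (p w))) = theta D k *s q (Q k (p w))"
      by (simp only: assms(6))
    show "(\<Sum>k\<le>D. q (Q k (p w))) = w"
      by (simp add: Y.sum_P assms(6) flip: module_hom.sum[OF assms(5)])
  qed
qed

lemma Estar_prim_nth: "(Estar_prim k *v w) $ y = (if cube_dist base_vertex y = k then w $ y else 0)"
  by (cases "cube_dist base_vertex y = k")
    (simp_all add: matrix_vector_mult_def Estar_prim_def if_distrib[of "\<lambda>a. a * _"] cong: if_cong)

lemma cube_Astar_nth: "(cube_Astar *v w) $ y = theta CARD('n) (cube_dist base_vertex y) * w $ y"
  for w :: "'n::finite cvec"
  by (simp add: matrix_vector_mult_def cube_Astar_def if_distrib[of "\<lambda>a. a * _"] cong: if_cong)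

lemma weight_operator_Astar:
  "weight_operator CARD('n) ((*v) (cube_Astar :: 'n::finite cmat)) (\<lambda>k. (*v) (Estar_prim k))"
proof (intro weight_operator.intro clinear_matrix herm_cube_Astar)
  show "(\<Sum>k\<le>CARD('n). Estar_prim k *v w) = w" for w :: "'n cvec"
    by (simp add: vec_eq_iff sum_component Estar_prim_nth cube_dist_base_le)
qed (simp_all add: vec_eq_iff Estar_prim_nth cube_Astar_nth)

lemma cube_P_inverse:
  "matrix_inv cube_P *v (cube_P *v w) = w" "cube_P *v (matrix_inv cube_P *v w) = w"
  for w :: "'n::finite cvec"
proof -
  have "cube_P ** matrix_inv cube_P = (mat 1 :: 'n cmat) \<and> matrix_inv cube_P ** (cube_P :: 'n cmat) = mat 1"
    using someI_ex[OF invertible_cube_P[unfolded invertible_def]] by (simp only: matrix_inv_def)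
  then show "matrix_inv cube_P *v (cube_P *v w) = w" "cube_P *v (matrix_inv cube_P *v w) = w"
    by (simp_all add: matrix_vector_mul_assoc)
qed

lemma mscale_vector: "mscale c M *v w = c *s (M *v w)"
  by (simp add: mscale_def vec_eq_iff matrix_vector_mult_def sum_distrib_left mult.assoc)

lemma E_prim_vector:
  "E_prim k *v w = lagrange_op CARD('n) ((*v) cube_A) k (filter (\<lambda>j. j \<noteq> k) [0..<Suc CARD('n)]) w"
  for w :: "'n::finite cvec"
proof -
  have "foldr (**) (map (\<lambda>j. mscale (1 / (theta CARD('n) k - theta CARD('n) j))
          (cube_A - mscale (theta CARD('n) j) (mat 1))) js) (mat 1) *v w
      = lagrange_op CARD('n) ((*v) cube_A) k js w" for js
    by (induction js) (simp_all add: mscale_vector matrix_vector_mult_diff_rdistrib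
        flip: matrix_vector_mul_assoc)
  then show ?thesis unfolding E_prim_def .
qed

text \<open>The spectrum of the diagonal \<open>cube_Astar\<close> is transported by
  \<open>cube_P\<close>; Lagrange interpolation then identifies the transported projections with
  \<open>E_prim\<close>.\<close>

lemma weight_operator_A:
  "weight_operator CARD('n) ((*v) (cube_A :: 'n::finite cmat)) (\<lambda>k. (*v) (E_prim k))"
proof -
  let ?Q = "\<lambda>k w. matrix_inv cube_P *v (Estar_prim k *v (cube_P *v w)) :: 'n cvec"
  interpret A: weight_operator "CARD('n)" "(*v) (cube_A :: 'n cmat)" ?Q
    by (rule weight_operator_conj[OF weight_operator_Astar clinear_matrix herm_cube_A
          clinear_matrix clinear_matrix cube_P_inverse])
      (simp add: matrix_vector_mul_assoc cube_P_A)
  have "(\<lambda>k. (*v) (E_prim k)) = ?Q"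
    unfolding fun_eq_iff E_prim_vector A.lagrange_op_eq by simp
  then show ?thesis using A.weight_operator_axioms by simp
qed

lemma weight_operator_Aeps:
  "weight_operator CARD('n) ((*v) (cube_Aeps :: 'n::finite cmat)) (\<lambda>k. (*v) (Eeps_prim k))"
proof -
  have "(\<lambda>k. (*v) (Eeps_prim k)) = (\<lambda>k w. matrix_inv cube_P *v (E_prim k *v (cube_P *v w)) :: 'n cvec)"
    by (simp add: fun_eq_iff Eeps_prim_def flip: matrix_vector_mul_assoc)
  then show ?thesis
    using weight_operator_conj[OF weight_operator_A clinear_matrix herm_cube_Aeps
          clinear_matrix clinear_matrix cube_P_inverse]
    by (simp add: matrix_vector_mul_assoc cube_P_Aeps)
qed

lemma cube_Aeps_vector:
  "cube_Aeps *v w = (- \<i> / 2) *s (cube_A *v (cube_Astar *v w) - cube_Astar *v (cube_A *v w))"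
  by (simp add: cube_Aeps_def mscale_vector matrix_vector_mult_diff_rdistrib matrix_vector_mul_assoc)

lemma weight_triple_cube:
  "weight_triple CARD('n) ((*v) (cube_A :: 'n::finite cmat)) ((*v) cube_Astar) ((*v) cube_Aeps)
     (\<lambda>k. (*v) (E_prim k)) (\<lambda>k. (*v) (Estar_prim k)) (\<lambda>k. (*v) (Eeps_prim k))"
proof (intro weight_triple.intro weight_triple_axioms.intro
    weight_operator_A weight_operator_Astar weight_operator_Aeps)
  let ?P = "(*v) (cube_P :: 'n cmat)" and ?A = "(*v) (cube_A :: 'n cmat)"
  let ?As = "(*v) (cube_Astar :: 'n cmat)" and ?Ae = "(*v) (cube_Aeps :: 'n cmat)"
  have inj: "v = w" if "?P v = ?P w" for v w
    using that cube_P_inverse(1) by metis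
  have P: "?P (?A w) = ?As (?P w)" "?P (?Ae w) = ?A (?P w)" "?P (?As w) = ?Ae (?P w)" for w
    by (simp_all add: matrix_vector_mul_assoc cube_P_A cube_P_Aeps cube_P_Astar)
  have P_lin: "?P (v - w) = ?P v - ?P w" "?P (c *s v) = c *s ?P v" for v w c
    by (simp_all add: module_hom.diff[OF clinear_matrix] module_hom.scale[OF clinear_matrix])
  show 1: "?A (?As w) - ?As (?A w) = (2 * \<i>) *s ?Ae w" for w
    by (simp add: cube_Aeps_vector)
  \<comment> \<open>Applying \<open>cube_P\<close> turns this relation into the previous one, and
    likewise for the third.\<close>
  show 2: "?Ae (?A w) - ?A (?Ae w) = (2 * \<i>) *s ?As w" for w
    by (rule inj) (simp add: P P_lin 1)
  show "?As (?Ae w) - ?Ae (?As w) = (2 * \<i>) *s ?A w" for w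
    by (rule inj) (simp add: P P_lin 2)
qed

lemma weight_module_cube:
  fixes W :: "'n::finite cvec set"
  assumes "T_module W" "W \<noteq> {0}"
  shows "weight_module CARD('n) ((*v) (cube_A :: 'n cmat)) ((*v) cube_Astar) ((*v) cube_Aeps)
     (\<lambda>k. (*v) (E_prim k)) (\<lambda>k. (*v) (Estar_prim k)) (\<lambda>k. (*v) (Eeps_prim k)) W"
proof (intro weight_module.intro weight_module_axioms.intro weight_triple_cube)
  show W: "vec.subspace W" using assms(1) by (simp add: T_module_def)
  have T: "B *v w \<in> W" if "B \<in> {cube_A, cube_Astar}" "w \<in> W" for B w
    using assms(1) that generated_algebra.gen[OF that(1)] unfolding T_module_def cube_T_def by blast
  show "cube_A *v w \<in> W" "cube_Astar *v w \<in> W" if "w \<in> W" for w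
    using T that by auto
  then show "cube_Aeps *v w \<in> W" if "w \<in> W" for w
    unfolding cube_Aeps_vector using that by (intro vec.subspace_scale vec.subspace_diff W) auto
  show "\<exists>w\<in>W. w \<noteq> 0" using assms(2) vec.subspace_0[OF W] by blast
qed

theorem theorem11p7:
  fixes W :: "(complex ^ (bool ^ 'n::finite)) set"
    and u ustar ueps :: "complex ^ (bool ^ 'n)"
    and r d i j :: nat
  assumes "irreducible_T_module W"
    and "r = module_endpoint W" and "d = module_diameter W"
    and "i \<le> d" and "j \<le> d"
    and "u \<in> (*v) (E_prim r) ` W" and "u \<noteq> 0"
    and "ustar \<in> (*v) (Estar_prim r) ` W" and "ustar \<noteq> 0"
    and "ueps \<in> (*v) (Eeps_prim r) ` W" and "ueps \<noteq> 0"
  shows "herm (E_prim (r + i) *v ueps) (Estar_prim (r + j) *v u) =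
           \<i> ^ i * (1 / 2 ^ d) * herm ueps u * of_nat (d choose i) * of_nat (d choose j) * hyp2F1 d i j
      \<and> herm (Estar_prim (r + i) *v u) (Eeps_prim (r + j) *v ustar) =
           \<i> ^ i * (1 / 2 ^ d) * herm u ustar * of_nat (d choose i) * of_nat (d choose j) * hyp2F1 d i j
      \<and> herm (Eeps_prim (r + i) *v ustar) (E_prim (r + j) *v ueps) =
           \<i> ^ i * (1 / 2 ^ d) * herm ustar ueps * of_nat (d choose i) * of_nat (d choose j) * hyp2F1 d i j"
proof -
  interpret m: weight_module "CARD('n)" "(*v) (cube_A :: 'n cmat)" "(*v) cube_Astar" "(*v) cube_Aeps"
    "\<lambda>k. (*v) (E_prim k)" "\<lambda>k. (*v) (Estar_prim k)" "\<lambda>k. (*v) (Eeps_prim k)" W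
    using assms(1) by (intro weight_module_cube) (auto simp: irreducible_T_module_def)
  note rot = m.rotate_module
  note rot2 = weight_module.rotate_module[OF rot]
  \<comment> \<open>The endpoint is defined through \<open>Estar_prim\<close>; equality of the
    minimal indices makes it the endpoint for all three operators.\<close>
  have r: "r = Min (weights CARD('n) ((*v) cube_A) W)"
    "r = Min (weights CARD('n) ((*v) cube_Astar) W)" "r = Min (weights CARD('n) ((*v) cube_Aeps) W)"
    using assms(2) m.y.weights_image[OF m.subspace_W m.Y_W] m.Min_weights_Y m.Min_weights_Z
    by (simp_all add: module_endpoint_def)
  have d: "d = CARD('n) - 2 * r"
    using assms(3) m.y.weights_image[OF m.subspace_W m.Y_W] m.weights_Y_eq[OF r(1)]
    by (simp add: module_diameter_def)
  have u: "u \<in> W" "cube_A *v u = theta CARD('n) r *s u"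
    using assms(6) m.x.P_in_subspace[OF m.subspace_W m.X_W] m.x.X_P by auto
  have us: "ustar \<in> W" "cube_Astar *v ustar = theta CARD('n) r *s ustar"
    using assms(8) m.y.P_in_subspace[OF m.subspace_W m.Y_W] m.y.X_P by auto
  have ue: "ueps \<in> W" "cube_Aeps *v ueps = theta CARD('n) r *s ueps"
    using assms(10) m.z.P_in_subspace[OF m.subspace_W m.Z_W] m.z.X_P by auto
  \<comment> \<open>The factor \<open>d choose j\<close> is absorbed into the Krawtchouk
    coefficient.\<close>
  have F: "a * of_nat (d choose i) * of_nat (d choose j) * hyp2F1 d i j
      = a * of_nat (d choose i) * coeff (krawtchouk_gf d i) j" for a
    using hyp2F1_eq_coeff[OF assms(4,5)] by (simp only: mult.assoc)
  show ?thesis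
    unfolding F
    using m.inner_product_components[OF r(1) d assms(4) ue u]
      weight_module.inner_product_components[OF rot r(2) d assms(4) u us]
      weight_module.inner_product_components[OF rot2 r(3) d assms(4) us ue]
    by blast
qed

end
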